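(* Let $k$ be a field and $A=k[[t^5,t^{11}]] \subseteq k[[t]]$. Let $f= t^{10} +\alpha_1 t^{11}+\alpha_2 t^{16} +\alpha_3 t^{22}$ and $g=t^{27}$ with $\alpha_1,\alpha_2,\alpha_3 \in k$ such that $\alpha_1 \ne 0$. Then $I=(f,g)$ is an Ulrich ideal of $A$. Moreover, the elements $\alpha_1,\alpha_2,\alpha_3$ in this expression of $I$ are uniquely determined by $I$.
   Context: $A$ is the semigroup ring of the numerical semigroup $\langle 5,11\rangle$, i.e. the subring of $k[[t]]$ of power series whose exponents lie in $\langle 5,11\rangle$. Ulrich ideal: let $(A,\mathfrak m)$ be a Cohen-Macaulay local ring of dimension one and $I$ an $\mathfrak m$-primary ideal containing a parameter ideal $Q=(x)$ as a reduction. $I$ is an Ulrich ideal of $A$ if (1) $I \neq Q$ and $I^2=QI$, and (2) $I/I^2$ is a free $A/I$-module. (Condition (1) does not depend on the choice of the reduction $Q$.) *)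

theory Defs
  imports
    "HOL-Algebra.Algebra"
    "HOL-Algebra.Algebraic_Closure_Type"
    "HOL-Computational_Algebra.Formal_Power_Series"
    "HOL-Library.Extended_Nat"
begin

section \<open>Cohen-Macaulay local rings\<close>

definition local_ring :: "('a, 'b) ring_scheme \<Rightarrow> 'a set \<Rightarrow> bool" where
  "local_ring R \<mm> \<longleftrightarrow>
     cring R \<and> maximalideal \<mm> R \<and> (\<forall>J. maximalideal J R \<longrightarrow> J = \<mm>)"

text \<open>Supremum of the lengths of strictly increasing chains
  \<open>P 0 \<subset> P 1 \<subset> \<dots> \<subset> P n\<close> of prime ideals.\<close>

definition krull_dim :: "('a, 'b) ring_scheme \<Rightarrow> enat" where
  "krull_dim R = Sup {enat n | n. \<exists>P :: nat \<Rightarrow> 'a set.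
     (\<forall>i\<le>n. primeideal (P i) R) \<and> (\<forall>i<n. P i \<subset> P (Suc i))}"

text \<open>The implication says that \<open>x\<^sub>i\<close> is a nonzerodivisor on
  \<open>R / (x\<^sub>0, \<dots>, x\<^sub>i\<^sub>-\<^sub>1)\<close>, written in \<open>R\<close> itself.\<close>

definition regular_sequence :: "('a, 'b) ring_scheme \<Rightarrow> 'a list \<Rightarrow> bool" where
  "regular_sequence R xs \<longleftrightarrow>
     set xs \<subseteq> carrier R \<and> Idl\<^bsub>R\<^esub> (set xs) \<noteq> carrier R \<and>
     (\<forall>i<length xs. \<forall>a\<in>carrier R.
        (xs ! i) \<otimes>\<^bsub>R\<^esub> a \<in> Idl\<^bsub>R\<^esub> (set (take i xs)) \<longrightarrow> a \<in> Idl\<^bsub>R\<^esub> (set (take i xs)))"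

definition depth :: "('a, 'b) ring_scheme \<Rightarrow> 'a set \<Rightarrow> enat" where
  "depth R \<mm> = Sup {enat (length xs) | xs. regular_sequence R xs \<and> set xs \<subseteq> \<mm>}"

definition cohen_macaulay_local :: "('a, 'b) ring_scheme \<Rightarrow> 'a set \<Rightarrow> bool" where
  "cohen_macaulay_local R \<mm> \<longleftrightarrow>
     noetherian_ring R \<and> local_ring R \<mm> \<and> depth R \<mm> = krull_dim R"


section \<open>Ideals\<close>

definition radical_ideal :: "('a, 'b) ring_scheme \<Rightarrow> 'a set \<Rightarrow> 'a set" where
  "radical_ideal R J = {x \<in> carrier R. \<exists>n::nat. x [^]\<^bsub>R\<^esub> n \<in> J}"

definition primary_ideal :: "('a, 'b) ring_scheme \<Rightarrow> 'a set \<Rightarrow> bool" where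
  "primary_ideal R J \<longleftrightarrow> ideal J R \<and> J \<noteq> carrier R \<and>
     (\<forall>a\<in>carrier R. \<forall>b\<in>carrier R. a \<otimes>\<^bsub>R\<^esub> b \<in> J \<longrightarrow> a \<in> J \<or> b \<in> radical_ideal R J)"

definition m_primary :: "('a, 'b) ring_scheme \<Rightarrow> 'a set \<Rightarrow> 'a set \<Rightarrow> bool" where
  "m_primary R \<mm> J \<longleftrightarrow> primary_ideal R J \<and> radical_ideal R J = \<mm>"

text \<open>\<open>ideals_set R\<close> is the semiring of ideals, so \<open>[^]\<close> below is the power of an ideal,
  with zeroth power \<open>carrier R\<close>.\<close>

definition reduction :: "('a, 'b) ring_scheme \<Rightarrow> 'a set \<Rightarrow> 'a set \<Rightarrow> bool" where
  "reduction R Q I \<longleftrightarrow> ideal Q R \<and> ideal I R \<and> Q \<subseteq> I \<and>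
     (\<exists>n::nat. I [^]\<^bsub>ideals_set R\<^esub> Suc n = Q \<cdot>\<^bsub>R\<^esub> (I [^]\<^bsub>ideals_set R\<^esub> n))"


section \<open>Free modules and \<open>I/I\<^sup>2\<close>\<close>

definition module_basis ::
    "('r, 'b) ring_scheme \<Rightarrow> ('r, 'm, 'c) module_scheme \<Rightarrow> 'm set \<Rightarrow> bool" where
  "module_basis R M B \<longleftrightarrow> B \<subseteq> carrier M \<and>
     (\<forall>x\<in>carrier M. \<exists>F c. finite F \<and> F \<subseteq> B \<and> c \<in> F \<rightarrow> carrier R \<and>
        x = (\<Oplus>\<^bsub>M\<^esub>b\<in>F. c b \<odot>\<^bsub>M\<^esub> b)) \<and>
     (\<forall>F c. finite F \<and> F \<subseteq> B \<and> c \<in> F \<rightarrow> carrier R \<and>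
        (\<Oplus>\<^bsub>M\<^esub>b\<in>F. c b \<odot>\<^bsub>M\<^esub> b) = \<zero>\<^bsub>M\<^esub> \<longrightarrow> (\<forall>b\<in>F. c b = \<zero>\<^bsub>R\<^esub>))"

definition free_module :: "('r, 'b) ring_scheme \<Rightarrow> ('r, 'm, 'c) module_scheme \<Rightarrow> bool" where
  "free_module R M \<longleftrightarrow> module R M \<and> (\<exists>B. module_basis R M B)"

text \<open>\<open>I/I\<^sup>2\<close> as a module over \<open>R Quot I\<close>: the cosets of \<open>I\<^sup>2\<close> in \<open>I\<close>, with scalar
  multiplication \<open>(I + r) \<odot> (I\<^sup>2 + a) = I\<^sup>2 + ra\<close>, which is what \<^const>\<open>rcoset_mult\<close> yields
  here because \<open>I \<cdot> I = I\<^sup>2\<close>.  The fields \<open>mult\<close> and \<open>one\<close> occur only because the module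
  record extends the ring record; the module axioms do not refer to them.\<close>

definition ideal_mod_square :: "('a, 'b) ring_scheme \<Rightarrow> 'a set \<Rightarrow> ('a set, 'a set) module" where
  "ideal_mod_square R I =
     \<lparr>carrier = (\<lambda>a. (I \<cdot>\<^bsub>R\<^esub> I) +>\<^bsub>R\<^esub> a) ` I,
      monoid.mult = rcoset_mult R (I \<cdot>\<^bsub>R\<^esub> I),
      monoid.one = (I \<cdot>\<^bsub>R\<^esub> I) +>\<^bsub>R\<^esub> \<one>\<^bsub>R\<^esub>,
      ring.zero = I \<cdot>\<^bsub>R\<^esub> I,
      ring.add = set_add R,
      module.smult = rcoset_mult R (I \<cdot>\<^bsub>R\<^esub> I)\<rparr>"


section \<open>Ulrich ideals\<close>

text \<open>In dimension one a parameter ideal is a principal ideal \<open>Q = (x)\<close> which is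
  \<open>\<mm>\<close>-primary.  The condition \<open>I \<noteq> Q \<and> I\<^sup>2 = QI\<close> does not depend on the choice of the
  parameter reduction \<open>Q\<close>, so it is required for some \<open>Q\<close>.\<close>

definition ulrich_ideal :: "('a, 'b) ring_scheme \<Rightarrow> 'a set \<Rightarrow> bool" where
  "ulrich_ideal R I \<longleftrightarrow>
     (\<exists>\<mm>. cohen_macaulay_local R \<mm> \<and> krull_dim R = 1 \<and> m_primary R \<mm> I \<and>
        (\<exists>x\<in>carrier R. m_primary R \<mm> (PIdl\<^bsub>R\<^esub> x) \<and> reduction R (PIdl\<^bsub>R\<^esub> x) I \<and>
           I \<noteq> PIdl\<^bsub>R\<^esub> x \<and> I \<cdot>\<^bsub>R\<^esub> I = (PIdl\<^bsub>R\<^esub> x) \<cdot>\<^bsub>R\<^esub> I) \<and>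
        free_module (R Quot I) (ideal_mod_square R I))"


section \<open>The ring \<open>k[[t\<^sup>5, t\<^sup>1\<^sup>1]]\<close>\<close>

definition semigroup_generated2 :: "nat \<Rightarrow> nat \<Rightarrow> nat set" where
  "semigroup_generated2 m n = {a * m + b * n | a b. True}"

text \<open>A subring of \<open>k[[t]]\<close>, with \<^const>\<open>fps_X\<close> in the role of \<open>t\<close>.\<close>

definition semigroup_ring :: "nat set \<Rightarrow> ('k::field) fps ring" where
  "semigroup_ring H =
     ring_of_type_algebra\<lparr>carrier := {F. \<forall>n. fps_nth F n \<noteq> 0 \<longrightarrow> n \<in> H}\<rparr>"

abbreviation A_5_11 :: "('k::field) fps ring" where
  "A_5_11 \<equiv> semigroup_ring (semigroup_generated2 5 11)"

definition ulrich_f :: "'k::field \<Rightarrow> 'k \<Rightarrow> 'k \<Rightarrow> 'k fps" where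
  "ulrich_f \<alpha>1 \<alpha>2 \<alpha>3 = fps_X ^ 10 + fps_const \<alpha>1 * fps_X ^ 11
     + fps_const \<alpha>2 * fps_X ^ 16 + fps_const \<alpha>3 * fps_X ^ 22"

definition ulrich_g :: "'k::field fps" where
  "ulrich_g = fps_X ^ 27"

end

theory Submission
  imports Defs
begin

text \<open>
  Write \<open>A\<close> for the ring, \<open>H\<close> for the semigroup generated by 5 and 11 (every \<open>n \<ge> 40\<close> lies
  in \<open>H\<close>), and \<open>I = (f, g)\<close>.  The key fact is that \<open>I\<close> consists of the
  multiples of \<open>f\<close> plus all series in \<open>A\<close> of order at least 25 (\<open>order_25_in_I\<close>,
  \<open>mem_I_iff\<close>).  Indeed the powers of \<open>t\<close> with exponent in \<open>H\<close> and at least 25 are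
  multiples of \<open>g\<close> or can be solved for from multiples of \<open>f\<close>; the exponents 33 and 44 need
  a division by \<open>\<alpha>\<^sub>1\<close>.  This turns membership in \<open>I\<close> into five linear equations between
  coefficients, and those equations, applied to another series of the form of \<open>f\<close>, force
  its parameters to be those of \<open>f\<close> (\<open>parameters_unique\<close>).

  The ideal \<open>Q = fA\<close> is the required reduction.  Since \<open>g\<^sup>2/f\<close> has order 44, it lies in
  \<open>I\<close>, and \<open>I\<^sup>2 = fI\<close> (\<open>square_eq\<close>).  Comparing coefficients shows \<open>(fA : g) \<subseteq> I\<close>
  (\<open>colon_subset_I\<close>); as \<open>1 \<notin> I\<close>, this gives \<open>I \<noteq> Q\<close>.  It also shows that a relation
  \<open>af + bg \<in> I\<^sup>2 = fI\<close> has both coefficients in \<open>I\<close> (\<open>relations_in_I\<close>), so the classes of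
  \<open>f\<close> and \<open>g\<close> are a basis of \<open>I/I\<^sup>2\<close> over \<open>A/I\<close>.

  The remaining ring-theoretic properties hold for every numerical semigroup ring.  A
  nonzero ideal contains all series of sufficiently large order (\<open>high_order_in_ideal\<close>), and
  a series with nonzero constant term is a unit.  Therefore the ring is local and
  noetherian, its only primes are zero and the maximal ideal, its depth is one, and every
  proper nonzero ideal is primary to the maximal ideal.
\<close>

section \<open>The module of an ideal modulo its square\<close>

context cring
begin

lemma quotient_carrier: "carrier (R Quot I) = (+>) I ` carrier R"
  by (auto simp: FactRing_def A_RCOSETS_def')

text \<open>The elementwise product of \<open>I + r\<close> and \<open>I\<^sup>2 + a\<close> stays in one coset because
  \<open>(i + r)(j + a) - ra = ij + ia + rj\<close> and each of these terms lies in \<open>I\<^sup>2\<close>; this is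
  where \<open>a \<in> I\<close> matters.\<close>

lemma ideal_mod_square_smult:
  assumes I: "ideal I R" and r: "r \<in> carrier R" and a: "a \<in> I"
  shows "rcoset_mult R (I \<cdot> I) (I +> r) (I \<cdot> I +> a) = I \<cdot> I +> (r \<otimes> a)"
proof -
  interpret I: ideal I R by (rule I)
  interpret J: ideal "I \<cdot> I" R by (rule ideal_prod_is_ideal[OF I I])
  have eq: "I \<cdot> I +> x \<otimes> y = I \<cdot> I +> r \<otimes> a" if x: "x \<in> I +> r" and y: "y \<in> I \<cdot> I +> a" for x y
  proof -
    obtain i where i: "i \<in> I" "x = i \<oplus> r" using x by (auto simp: a_r_coset_def')
    obtain j where j: "j \<in> I \<cdot> I" "y = j \<oplus> a" using y by (auto simp: a_r_coset_def')
    have c: "i \<in> carrier R" "j \<in> carrier R" "a \<in> carrier R" using i j a by auto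
    have "x \<otimes> y \<ominus> r \<otimes> a = i \<otimes> j \<oplus> i \<otimes> a \<oplus> r \<otimes> j"
      unfolding i(2) j(2) using c r by algebra
    moreover have "i \<otimes> j \<in> I \<cdot> I" "i \<otimes> a \<in> I \<cdot> I" "r \<otimes> j \<in> I \<cdot> I"
      using i j a c r by (auto intro: ideal_prod.prod J.I_l_closed)
    ultimately have "x \<otimes> y \<ominus> r \<otimes> a \<in> I \<cdot> I" by simp
    then show ?thesis
      using quotient_eq_iff_same_a_r_cos[OF J.ideal_axioms] c r i j by simp
  qed
  have "r \<in> I +> r" "a \<in> I \<cdot> I +> a"
    using r a I.a_rcos_self J.a_rcos_self by auto
  then show ?thesis unfolding rcoset_mult_def using eq by blast
qed

lemma ideal_mod_square_add:
  assumes I: "ideal I R" and "a \<in> I" "b \<in> I"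
  shows "(I \<cdot> I +> a) <+> (I \<cdot> I +> b) = I \<cdot> I +> (a \<oplus> b)"
  using ideal.a_rcos_sum[OF ideal_prod_is_ideal[OF I I]] assms ideal.Icarr[OF I] by blast

lemma ideal_mod_square_module:
  assumes I: "ideal I R"
  shows "module (R Quot I) (ideal_mod_square R I)"
proof -
  interpret I: ideal I R by (rule I)
  interpret J: ideal "I \<cdot> I" R by (rule ideal_prod_is_ideal[OF I I])
  have J0: "I \<cdot> I = I \<cdot> I +> \<zero>"
    using a_rcos_zero[OF J.ideal_axioms] by simp
  note defs = ideal_mod_square_def quotient_carrier
  have ab: "abelian_group (ideal_mod_square R I)"
  proof (rule abelian_groupI)
    fix x assume "x \<in> carrier (ideal_mod_square R I)"
    then obtain a where a: "a \<in> I" "x = I \<cdot> I +> a" by (auto simp: defs)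
    have "(I \<cdot> I +> \<ominus> a) <+> (I \<cdot> I +> a) = I \<cdot> I"
      using a J0 by (simp add: ideal_mod_square_add[OF I] l_neg)
    then show "\<exists>y\<in>carrier (ideal_mod_square R I).
        y \<oplus>\<^bsub>ideal_mod_square R I\<^esub> x = \<zero>\<^bsub>ideal_mod_square R I\<^esub>"
      using a by (auto simp: defs)
    have "(I \<cdot> I) <+> (I \<cdot> I +> a) = I \<cdot> I +> a"
      using a J0 ideal_mod_square_add[OF I, of \<zero> a] by simp
    then show "\<zero>\<^bsub>ideal_mod_square R I\<^esub> \<oplus>\<^bsub>ideal_mod_square R I\<^esub> x = x"
      using a by (auto simp: defs)
  next
    show "\<zero>\<^bsub>ideal_mod_square R I\<^esub> \<in> carrier (ideal_mod_square R I)"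
      using J0 by (auto simp: defs)
  next
    fix x y assume "x \<in> carrier (ideal_mod_square R I)" "y \<in> carrier (ideal_mod_square R I)"
    then obtain a b where "a \<in> I" "x = I \<cdot> I +> a" "b \<in> I" "y = I \<cdot> I +> b" by (auto simp: defs)
    then show "x \<oplus>\<^bsub>ideal_mod_square R I\<^esub> y = y \<oplus>\<^bsub>ideal_mod_square R I\<^esub> x"
      by (simp add: defs ideal_mod_square_add[OF I] a_comm[of a b])
  qed (auto simp: defs ideal_mod_square_add[OF I] a_assoc)
  show ?thesis
  proof (rule moduleI[OF I.quotient_is_cring[OF cring_axioms] ab])
  qed (auto simp: defs FactRing_def ideal_mod_square_add[OF I] ideal_mod_square_smult[OF I]
        I.a_rcos_sum I.rcoset_mult_add I.I_l_closed l_distr r_distr m_assoc A_RCOSETS_def')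
qed

text \<open>Freeness of \<open>I/I\<^sup>2\<close> in terms of elements of the ring: the classes of two generators
  form a basis exactly because every relation between them modulo \<open>I\<^sup>2\<close> has coefficients
  in \<open>I\<close>.\<close>

lemma free_ideal_mod_square_of_two_generators:
  assumes I: "ideal I R" and one: "\<one> \<notin> I" and x: "x \<in> I" and y: "y \<in> I"
    and gen: "\<And>z. z \<in> I \<Longrightarrow> \<exists>a\<in>carrier R. \<exists>b\<in>carrier R. z = a \<otimes> x \<oplus> b \<otimes> y"
    and indep: "\<And>a b. a \<in> carrier R \<Longrightarrow> b \<in> carrier R \<Longrightarrow> a \<otimes> x \<oplus> b \<otimes> y \<in> I \<cdot> I \<Longrightarrow> a \<in> I \<and> b \<in> I"
  shows "free_module (R Quot I) (ideal_mod_square R I)"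
proof -
  interpret I: ideal I R by (rule I)
  interpret J: ideal "I \<cdot> I" R by (rule ideal_prod_is_ideal[OF I I])
  interpret M: module "R Quot I" "ideal_mod_square R I" by (rule ideal_mod_square_module[OF I])
  let ?M = "ideal_mod_square R I" and ?p = "(+>) (I \<cdot> I)"
  let ?B = "{?p x, ?p y}"
  have xc: "x \<in> carrier R" "y \<in> carrier R" using x y by auto
  have pM: "?p a \<in> carrier ?M" if "a \<in> I" for a using that by (auto simp: ideal_mod_square_def)
  have p0: "?p a = \<zero>\<^bsub>?M\<^esub> \<longleftrightarrow> a \<in> I \<cdot> I" if "a \<in> carrier R" for a
    using that a_rcos_zero[OF J.ideal_axioms] J.rcos_const_imp_mem
    by (auto simp: ideal_mod_square_def)
  have q0: "I +> a = \<zero>\<^bsub>R Quot I\<^esub> \<longleftrightarrow> a \<in> I" if "a \<in> carrier R" for a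
    using that a_rcos_zero[OF I] I.rcos_const_imp_mem by (auto simp: FactRing_def)
  \<comment> \<open>Equal classes would give the relation \<open>1 \<cdot> x - 1 \<cdot> y \<in> I\<^sup>2\<close> with coefficient outside \<open>I\<close>.\<close>
  have ne: "?p x \<noteq> ?p y"
  proof
    assume "?p x = ?p y"
    then have "x \<ominus> y \<in> I \<cdot> I"
      using quotient_eq_iff_same_a_r_cos[OF J.ideal_axioms] xc by blast
    moreover have "x \<ominus> y = \<one> \<otimes> x \<oplus> (\<ominus> \<one>) \<otimes> y" using xc by algebra
    ultimately show False using indep[of \<one> "\<ominus> \<one>"] one by auto
  qed
  have comb: "(I +> a) \<odot>\<^bsub>?M\<^esub> ?p x \<oplus>\<^bsub>?M\<^esub> (I +> b) \<odot>\<^bsub>?M\<^esub> ?p y = ?p (a \<otimes> x \<oplus> b \<otimes> y)"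
    if "a \<in> carrier R" "b \<in> carrier R" for a b
    using that x y
    by (simp add: ideal_mod_square_def ideal_mod_square_smult[OF I] ideal_mod_square_add[OF I] I.I_l_closed)
  have sumB: "(\<Oplus>\<^bsub>?M\<^esub>b\<in>?B. c b \<odot>\<^bsub>?M\<^esub> b) = c (?p x) \<odot>\<^bsub>?M\<^esub> ?p x \<oplus>\<^bsub>?M\<^esub> c (?p y) \<odot>\<^bsub>?M\<^esub> ?p y"
    if "c \<in> ?B \<rightarrow> carrier (R Quot I)" for c
  proof -
    have "c (?p x) \<odot>\<^bsub>?M\<^esub> ?p x \<in> carrier ?M" "c (?p y) \<odot>\<^bsub>?M\<^esub> ?p y \<in> carrier ?M"
      using that pM x y by auto
    then show ?thesis using ne by (simp add: M.finsum_insert)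
  qed
  have "module_basis (R Quot I) ?M ?B"
    unfolding module_basis_def
  proof (intro conjI ballI allI impI)
    show "?B \<subseteq> carrier ?M" using pM x y by auto
  next
    fix z assume "z \<in> carrier ?M"
    then obtain w where w: "w \<in> I" "z = ?p w" by (auto simp: ideal_mod_square_def)
    obtain a b where ab: "a \<in> carrier R" "b \<in> carrier R" "w = a \<otimes> x \<oplus> b \<otimes> y"
      using gen[OF w(1)] by blast
    define c where "c = (\<lambda>u. if u = ?p x then I +> a else I +> b)"
    have c: "c \<in> ?B \<rightarrow> carrier (R Quot I)" using ab by (auto simp: c_def quotient_carrier)
    have "z = (\<Oplus>\<^bsub>?M\<^esub>b\<in>?B. c b \<odot>\<^bsub>?M\<^esub> b)"
      unfolding sumB[OF c] using ne w ab comb by (simp add: c_def)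
    then show "\<exists>F c. finite F \<and> F \<subseteq> ?B \<and> c \<in> F \<rightarrow> carrier (R Quot I) \<and>
        z = (\<Oplus>\<^bsub>?M\<^esub>b\<in>F. c b \<odot>\<^bsub>?M\<^esub> b)"
      using c by (intro exI[of _ ?B] exI[of _ c]) auto
  next
    fix F c
    assume A: "finite F \<and> F \<subseteq> ?B \<and> c \<in> F \<rightarrow> carrier (R Quot I) \<and>
        (\<Oplus>\<^bsub>?M\<^esub>b\<in>F. c b \<odot>\<^bsub>?M\<^esub> b) = \<zero>\<^bsub>?M\<^esub>"
    \<comment> \<open>Extending the coefficients by zero reduces any relation to one on both basis elements.\<close>
    define d where "d = (\<lambda>u. if u \<in> F then c u else \<zero>\<^bsub>R Quot I\<^esub>)"
    have d: "d \<in> ?B \<rightarrow> carrier (R Quot I)" using A by (auto simp: d_def)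
    have "(\<Oplus>\<^bsub>?M\<^esub>b\<in>?B. d b \<odot>\<^bsub>?M\<^esub> b) = (\<Oplus>\<^bsub>?M\<^esub>b\<in>F. c b \<odot>\<^bsub>?M\<^esub> b)"
      using A pM x y
      by (intro M.add.finprod_mono_neutral_cong_right) (auto simp: d_def)
    then have s: "d (?p x) \<odot>\<^bsub>?M\<^esub> ?p x \<oplus>\<^bsub>?M\<^esub> d (?p y) \<odot>\<^bsub>?M\<^esub> ?p y = \<zero>\<^bsub>?M\<^esub>"
      using A sumB[OF d] by simp
    obtain a b where ab: "a \<in> carrier R" "d (?p x) = I +> a" "b \<in> carrier R" "d (?p y) = I +> b"
      using d by (auto simp: quotient_carrier)
    have "a \<otimes> x \<oplus> b \<otimes> y \<in> I \<cdot> I"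
      using s comb[OF ab(1,3)] p0[of "a \<otimes> x \<oplus> b \<otimes> y"] ab(1,3) xc unfolding ab(2,4) by simp
    then have "d (?p x) = \<zero>\<^bsub>R Quot I\<^esub>" "d (?p y) = \<zero>\<^bsub>R Quot I\<^esub>"
      using indep[OF ab(1,3)] q0[OF ab(1)] q0[OF ab(3)] unfolding ab(2,4) by blast+
    then show "c u = \<zero>\<^bsub>R Quot I\<^esub>" if "u \<in> F" for u
      using A that by (auto simp: d_def split: if_splits)
  qed
  then show ?thesis unfolding free_module_def using M.module_axioms by blast
qed

end

section \<open>Rings of numerical semigroups\<close>

locale numerical_semigroup_ring =
  fixes H :: "nat set" and c :: nat and R :: "'k::field fps ring" (structure)
  assumes R_def: "R = semigroup_ring H"
    and zero_in_H: "0 \<in> H"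
    and add_in_H: "m \<in> H \<Longrightarrow> n \<in> H \<Longrightarrow> m + n \<in> H"
    and conductor: "c \<le> n \<Longrightarrow> n \<in> H"
begin

lemma carrier_iff: "F \<in> carrier R \<longleftrightarrow> (\<forall>n. fps_nth F n \<noteq> 0 \<longrightarrow> n \<in> H)"
  by (simp add: R_def semigroup_ring_def)

lemma ring_operations [simp]:
  "F \<otimes> G = F * G" "F \<oplus> G = F + G" "\<one> = 1" "\<zero> = 0"
  by (simp_all add: R_def semigroup_ring_def ring_of_type_algebra_def)

lemma times_closed:
  assumes "F \<in> carrier R" "G \<in> carrier R"
  shows "F * G \<in> carrier R"
  unfolding carrier_iff
proof (intro allI impI)
  fix n assume "fps_nth (F * G) n \<noteq> 0"
  then obtain i where "i \<le> n" "fps_nth F i * fps_nth G (n - i) \<noteq> 0"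
    unfolding fps_mult_nth by (metis (no_types, lifting) atLeastAtMost_iff sum.neutral)
  then show "n \<in> H"
    using assms add_in_H[of i "n - i"] by (auto simp: carrier_iff)
qed

lemma add_closed: "F \<in> carrier R \<Longrightarrow> G \<in> carrier R \<Longrightarrow> F + G \<in> carrier R"
  by (auto simp: carrier_iff) (metis add_0_right)

lemma uminus_closed: "F \<in> carrier R \<Longrightarrow> - F \<in> carrier R"
  by (simp add: carrier_iff)

lemma is_domain: "domain R"
proof -
  have "cring R"
  proof (rule cringI)
    show "abelian_group R"
    proof (rule abelian_groupI)
      fix F assume "F \<in> carrier R"
      then show "\<exists>G\<in>carrier R. G \<oplus> F = \<zero>"
        using uminus_closed by (intro bexI[of _ "- F"]) auto
    qed (auto simp: add_closed algebra_simps, auto simp: carrier_iff)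
    show "comm_monoid R"
      by (rule comm_monoidI) (auto simp: times_closed algebra_simps, auto simp: carrier_iff zero_in_H)
  qed (auto simp: algebra_simps)
  then show ?thesis
    by (rule domain.intro) (unfold_locales, auto)
qed

end

sublocale numerical_semigroup_ring \<subseteq> domain R
  by (rule is_domain)

context numerical_semigroup_ring
begin

lemma minus_eq_uminus:
  assumes "F \<in> carrier R"
  shows "\<ominus> F = - F"
proof (rule sum_zero_eq_neg[symmetric])
qed (use assms in \<open>auto simp: uminus_closed\<close>)

lemma diff_closed:
  assumes "F \<in> carrier R" "G \<in> carrier R"
  shows "F - G \<in> carrier R"
  using add_closed[OF assms(1) uminus_closed[OF assms(2)]] by simp

lemma nat_pow_eq_power [simp]: "F [^] (n::nat) = F ^ n"
  by (induction n) (auto simp: mult.commute)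

lemma ideal_minus:
  assumes "ideal J R" "F \<in> J" "G \<in> J"
  shows "F - G \<in> J"
proof -
  interpret ideal J R by fact
  have "F \<oplus> (\<ominus> G) \<in> J" using assms by (intro a_closed a_inv_closed) auto
  then show ?thesis using assms Icarr by (simp add: minus_eq_uminus)
qed

lemma ideal_times: "ideal J R \<Longrightarrow> F \<in> J \<Longrightarrow> a \<in> carrier R \<Longrightarrow> a * F \<in> J"
  using ideal.I_l_closed[of J R F a] by simp

lemma ideal_plus: "ideal J R \<Longrightarrow> F \<in> J \<Longrightarrow> G \<in> J \<Longrightarrow> F + G \<in> J"
  using additive_subgroup.a_closed[OF ideal.axioms(1), of J R F G] by simp

lemma const_closed: "fps_const a \<in> carrier R"
  by (simp add: carrier_iff zero_in_H)

lemma power_of_t_closed: "n \<in> H \<Longrightarrow> fps_X ^ n \<in> carrier R"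
  by (simp add: carrier_iff)

lemma beyond_conductor_closed: "(\<forall>i<c. fps_nth F i = 0) \<Longrightarrow> F \<in> carrier R"
  unfolding carrier_iff by (intro allI impI conductor) (rule ccontr, simp)

lemma genideal_pair:
  assumes x: "x \<in> carrier R" and y: "y \<in> carrier R"
  shows "Idl {x, y} = {a * x + b * y | a b. a \<in> carrier R \<and> b \<in> carrier R}"
proof -
  define S where "S = (\<lambda>(a, b). a * x + b * y) ` (carrier R \<times> carrier R)"
  have S_I: "a * x + b * y \<in> S" if "a \<in> carrier R" "b \<in> carrier R" for a b
    using that by (auto simp: S_def)
  have S_E: "\<exists>a\<in>carrier R. \<exists>b\<in>carrier R. F = a * x + b * y" if "F \<in> S" for F
    using that by (auto simp: S_def)
  have zero: "0 \<in> carrier R" and one: "1 \<in> carrier R" using zero_closed one_closed by simp_all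
  have scale: "r * F \<in> S" if F: "F \<in> S" and r: "r \<in> carrier R" for F r
  proof -
    obtain a b where ab: "a \<in> carrier R" "b \<in> carrier R" "F = a * x + b * y" using S_E[OF F] by blast
    have "(r * a) * x + (r * b) * y \<in> S" using ab r by (intro S_I times_closed)
    then show ?thesis by (simp add: ab(3) algebra_simps)
  qed
  have S: "ideal S R"
  proof (rule idealI)
    show "ring R" by (rule ring_axioms)
    show "subgroup S (add_monoid R)"
    proof (rule add.subgroupI)
      show sub: "S \<subseteq> carrier R" using x y S_E add_closed times_closed by blast
      show "S \<noteq> {}" using S_I[OF zero zero] by blast
      fix F assume F: "F \<in> S"
      have "(- 1) * F \<in> S" by (rule scale[OF F uminus_closed[OF one]])
      then show "\<ominus> F \<in> S" using F sub by (simp add: minus_eq_uminus subsetD)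
      fix G assume G: "G \<in> S"
      obtain a b where ab: "a \<in> carrier R" "b \<in> carrier R" "F = a * x + b * y"
        using S_E[OF F] by blast
      obtain a' b' where ab': "a' \<in> carrier R" "b' \<in> carrier R" "G = a' * x + b' * y"
        using S_E[OF G] by blast
      have "(a + a') * x + (b + b') * y \<in> S" using ab ab' by (intro S_I add_closed)
      then show "F \<oplus> G \<in> S" by (simp add: ab(3) ab'(3) algebra_simps)
    qed
  qed (use scale in \<open>simp_all add: mult.commute\<close>)
  have xy: "{x, y} \<subseteq> carrier R" using x y by blast
  note idl = genideal_ideal[OF xy]
  have "x \<in> S" "y \<in> S" using S_I[OF one zero] S_I[OF zero one] by simp_all
  then have "Idl {x, y} \<subseteq> S" by (intro genideal_minimal[OF S]) simp
  moreover have "x \<in> Idl {x, y}" "y \<in> Idl {x, y}" using genideal_self[OF xy] by simp_all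
  then have "S \<subseteq> Idl {x, y}"
    using S_E ideal_plus[OF idl] ideal_times[OF idl] by blast
  ultimately have "Idl {x, y} = S" by (rule equalityI)
  also have "S = {a * x + b * y | a b. a \<in> carrier R \<and> b \<in> carrier R}"
    by (auto simp: S_def)
  finally show ?thesis .
qed

lemma ideal_sum:
  assumes "ideal J R" "finite S" "\<And>i. i \<in> S \<Longrightarrow> h i \<in> J"
  shows "sum h S \<in> J"
  using assms(2,3)
proof (induction S)
  case empty
  then show ?case using additive_subgroup.zero_closed[OF ideal.axioms(1)[OF assms(1)]] by simp
qed (simp add: ideal_plus[OF assms(1)])

text \<open>The recursion for the coefficients of an inverse series writes a nonzero coefficient at
  \<open>n > 0\<close> as a sum of products whose exponents add up to \<open>n\<close>; by induction both exponents
  of some nonzero product lie in \<open>H\<close>.  Hence the units are the series with nonzero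
  constant term, and the ring is local.\<close>

lemma inverse_closed:
  assumes "F \<in> carrier R" "fps_nth F 0 \<noteq> 0"
  shows "inverse F \<in> carrier R"
  unfolding carrier_iff
proof (intro allI impI)
  fix n
  show "fps_nth (inverse F) n \<noteq> 0 \<Longrightarrow> n \<in> H"
  proof (induction n rule: less_induct)
    case (less n)
    show ?case
    proof (cases "n = 0")
      case False
      have "fps_nth (inverse F * F) n = 0"
        using assms(2) False by (simp add: inverse_mult_eq_1)
      then have "(\<Sum>i\<in>{0..n}. fps_nth (inverse F) i * fps_nth F (n - i)) = 0"
        by (simp add: fps_mult_nth)
      moreover have "(\<Sum>i\<in>{0..n}. fps_nth (inverse F) i * fps_nth F (n - i)) =
          (\<Sum>i\<in>{0..<n}. fps_nth (inverse F) i * fps_nth F (n - i)) + fps_nth (inverse F) n * fps_nth F 0"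
        by (simp add: sum.last_plus add.commute)
      ultimately have "(\<Sum>i\<in>{0..<n}. fps_nth (inverse F) i * fps_nth F (n - i)) \<noteq> 0"
        using less.prems assms(2) by auto
      then obtain i where i: "i < n" "fps_nth (inverse F) i * fps_nth F (n - i) \<noteq> 0"
        by (metis (no_types, lifting) atLeastLessThan_iff sum.neutral)
      then show ?thesis
        using less.IH[of i] assms(1) add_in_H[of i "n - i"] by (auto simp: carrier_iff)
    qed (simp add: zero_in_H)
  qed
qed

definition max_ideal :: "'k fps set" where
  "max_ideal = {F \<in> carrier R. fps_nth F 0 = 0}"

lemma max_ideal_ideal: "ideal max_ideal R"
proof (rule idealI)
  show "subgroup max_ideal (add_monoid R)"
    by (rule add.subgroupI)
      (auto simp: max_ideal_def add_closed uminus_closed minus_eq_uminus a_inv_def[symmetric])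
qed (auto simp: max_ideal_def times_closed ring_axioms)

lemma max_ideal_proper: "max_ideal \<noteq> carrier R"
proof
  assume "max_ideal = carrier R"
  then have "1 \<in> max_ideal" using one_closed by simp
  then show False by (simp add: max_ideal_def)
qed

lemma proper_ideal_subset_max_ideal:
  assumes J: "ideal J R" "J \<noteq> carrier R"
  shows "J \<subseteq> max_ideal"
proof
  interpret J: ideal J R by fact
  fix F assume F: "F \<in> J"
  show "F \<in> max_ideal"
  proof (rule ccontr)
    assume "F \<notin> max_ideal"
    then have F0: "fps_nth F 0 \<noteq> 0" using F J.Icarr by (auto simp: max_ideal_def)
    then have "inverse F * F \<in> J"
      using F inverse_closed J.Icarr J.I_l_closed[of F "inverse F"] by auto
    then show False
      using J(2) J.one_imp_carrier F0 by (simp add: inverse_mult_eq_1)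
  qed
qed

lemma local_ring: "local_ring R max_ideal"
  unfolding local_ring_def
proof (intro conjI allI impI)
  show "maximalideal max_ideal R"
    by (rule maximalidealI[OF max_ideal_ideal])
      (use max_ideal_proper proper_ideal_subset_max_ideal in blast)+
  fix J assume "maximalideal J R"
  then interpret J: maximalideal J R .
  have "J \<subseteq> max_ideal"
    using proper_ideal_subset_max_ideal[OF J.ideal_axioms] J.I_notcarr by auto
  then show "J = max_ideal"
    using J.I_maximal[OF max_ideal_ideal] max_ideal_proper by (auto simp: max_ideal_def)
qed (rule cring_axioms)

text \<open>The quotient \<open>F / x\<close> formed in the full power series ring has order at least \<open>c\<close>, and
  every series of that order lies in \<open>R\<close>.  So a nonzero ideal contains all series of large
  order; \<open>\<mm>\<close>-primariness, dimension, depth and finite generation below all rest on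
  this.\<close>

lemma high_order_multiple:
  assumes "x \<noteq> 0" "\<forall>i < subdegree x + c. fps_nth F i = 0"
  shows "\<exists>a\<in>carrier R. F = x * a"
proof (cases "F = 0")
  case True
  then show ?thesis by (intro bexI[of _ 0]) (auto simp: carrier_iff)
next
  case False
  then have sub: "subdegree x + c \<le> subdegree F"
    using assms(2) nth_subdegree_nonzero[of F] by (metis not_less)
  then have "x dvd F" using assms(1) False by (simp add: fps_dvd_iff)
  then obtain a where a: "F = x * a" by (rule dvdE)
  then have "subdegree F = subdegree x + subdegree a"
    using assms(1) False by auto
  then have "c \<le> subdegree a" using sub by simp
  then have "a \<in> carrier R" by (intro beyond_conductor_closed allI impI nth_less_subdegree_zero) simp
  then show ?thesis using a by blast
qed

lemma high_order_in_ideal: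
  assumes J: "ideal J R" and x: "x \<in> J" "x \<noteq> 0"
    and F: "\<forall>i < subdegree x + c. fps_nth F i = 0"
  shows "F \<in> J"
  using high_order_multiple[OF x(2) F] ideal_times[OF J x(1)] by (auto simp: mult.commute)

lemma power_in_ideal:
  assumes J: "ideal J R" and x: "x \<in> J" "x \<noteq> 0" and y: "y \<in> max_ideal"
  shows "y ^ (subdegree x + c) \<in> J"
  using high_order_in_ideal[OF J x] startsby_zero_power_prefix[of y] y
  by (auto simp: max_ideal_def)

text \<open>Powers of an element of the maximal ideal eventually enter any nonzero ideal, and an
  element outside the maximal ideal is a unit that can be cancelled.\<close>

lemma proper_nonzero_ideal_m_primary:
  assumes J: "ideal J R" and proper: "J \<noteq> carrier R" and x: "x \<in> J" "x \<noteq> 0"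
  shows "m_primary R max_ideal J"
proof -
  interpret J: ideal J R by fact
  have sub: "J \<subseteq> max_ideal" by (rule proper_ideal_subset_max_ideal[OF J proper])
  have rad: "radical_ideal R J = max_ideal"
  proof
    show "radical_ideal R J \<subseteq> max_ideal"
      using sub fps_power_zeroth by (fastforce simp: radical_ideal_def max_ideal_def)
    show "max_ideal \<subseteq> radical_ideal R J"
      using power_in_ideal[OF J x] by (auto simp: radical_ideal_def max_ideal_def)
  qed
  have "a \<in> J" if "a \<in> carrier R" "b \<in> carrier R" "a \<otimes> b \<in> J" "b \<notin> max_ideal" for a b
  proof -
    have b0: "fps_nth b 0 \<noteq> 0" using that by (auto simp: max_ideal_def)
    have "inverse b * (a * b) \<in> J"
      using ideal_times[OF J _ inverse_closed[OF that(2) b0]] that(3) by simp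
    moreover have "inverse b * (a * b) = a * (inverse b * b)" by (simp only: mult.left_commute)
    ultimately show ?thesis using b0 by (simp add: inverse_mult_eq_1)
  qed
  then show ?thesis
    unfolding m_primary_def primary_ideal_def using rad J proper by blast
qed

lemma t_power_in_max_ideal: "fps_X ^ Suc c \<in> max_ideal"
  by (simp only: max_ideal_def mem_Collect_eq power_of_t_closed conductor fps_X_power_nth) simp

lemma prime_ideal_iff: "primeideal P R \<longleftrightarrow> P = {0} \<or> P = max_ideal"
proof
  assume "primeideal P R"
  then interpret P: primeideal P R .
  show "P = {0} \<or> P = max_ideal"
  proof (rule disjCI)
    assume "P \<noteq> max_ideal"
    show "P = {0}"
    proof (rule ccontr)
      assume "P \<noteq> {0}"
      moreover have "0 \<in> P" using P.zero_closed by simp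
      ultimately obtain x where x: "x \<in> P" "x \<noteq> 0" by auto
      have "y \<in> P" if y: "y \<in> max_ideal" for y
      proof -
        have "y ^ n \<in> P \<Longrightarrow> y \<in> P" for n
        proof (induction n)
          case 0
          then show ?case using P.one_imp_carrier P.I_notcarr by simp
        next
          case (Suc n)
          have "y [^] n \<in> carrier R" using y by (intro nat_pow_closed) (simp add: max_ideal_def)
          then show ?case using Suc P.I_prime[of y "y ^ n"] y by (auto simp: max_ideal_def)
        qed
        then show ?thesis using power_in_ideal[OF P.ideal_axioms x y] by blast
      qed
      then have "max_ideal \<subseteq> P" by blast
      moreover have "P \<subseteq> max_ideal"
        using proper_ideal_subset_max_ideal[OF P.ideal_axioms] P.I_notcarr by auto
      ultimately show False using \<open>P \<noteq> max_ideal\<close> by blast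
    qed
  qed
next
  have "maximalideal max_ideal R" using local_ring by (simp add: local_ring_def)
  then have "primeideal max_ideal R" by (rule maximalideal_prime)
  moreover have "primeideal {0} R" using zeroprimeideal by simp
  ultimately show "P = {0} \<or> P = max_ideal \<Longrightarrow> primeideal P R" by blast
qed

lemma krull_dim_eq_1: "krull_dim R = 1"
  unfolding krull_dim_def
proof (rule cSup_eq_maximum)
  have "0 \<in> max_ideal" by (simp add: max_ideal_def carrier_iff)
  moreover have "\<exists>x\<in>max_ideal. x \<noteq> 0"
    using t_power_in_max_ideal by (rule bexI[rotated]) simp
  ultimately have ne: "{0} \<subset> max_ideal" by blast
  let ?P = "\<lambda>i::nat. if i = 0 then {0} else max_ideal"
  have "(\<forall>i\<le>1. primeideal (?P i) R) \<and> (\<forall>i<1. ?P i \<subset> ?P (Suc i))"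
    using prime_ideal_iff ne by auto
  then show "1 \<in> {enat n |n. \<exists>P. (\<forall>i\<le>n. primeideal (P i) R) \<and> (\<forall>i<n. P i \<subset> P (Suc i))}"
    unfolding one_enat_def by (intro CollectI exI[of _ 1], intro conjI exI[of _ ?P]) simp_all
next
  fix d assume "d \<in> {enat n |n. \<exists>P. (\<forall>i\<le>n. primeideal (P i) R) \<and> (\<forall>i<n. P i \<subset> P (Suc i))}"
  then obtain n P where d: "d = enat n" and P: "\<forall>i\<le>n. primeideal (P i) R" "\<forall>i<n. P i \<subset> P (Suc i)"
    by blast
  have "n \<le> 1"
  proof (rule ccontr)
    assume "\<not> n \<le> 1"
    then have "P 0 \<subset> P 1" "P 1 \<subset> P 2" "primeideal (P 0) R" "primeideal (P 1) R" "primeideal (P 2) R"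
      using P by (auto simp: numeral_2_eq_2)
    moreover have "{0} \<subseteq> max_ideal" by (auto simp: max_ideal_def carrier_iff)
    ultimately show False unfolding prime_ideal_iff by auto
  qed
  then show "d \<le> 1" by (simp add: d one_enat_def)
qed

text \<open>A second element \<open>y\<close> of a regular sequence would have a power in \<open>(x)\<close>; cancelling the
  factors \<open>y\<close> one at a time would put \<open>1\<close> into \<open>(x)\<close>.\<close>

lemma depth_eq_1: "depth R max_ideal = 1"
  unfolding depth_def
proof (rule cSup_eq_maximum)
  let ?x = "fps_X ^ Suc c :: 'k fps"
  have x: "?x \<in> carrier R" using t_power_in_max_ideal by (simp add: max_ideal_def del: power_Suc)
  have "Idl {?x} \<subseteq> max_ideal"
    by (rule genideal_minimal[OF max_ideal_ideal]) (use t_power_in_max_ideal in blast)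
  then have "Idl {?x} \<noteq> carrier R" using max_ideal_proper by (auto simp: max_ideal_def)
  moreover have "Idl {} = {0}" using genideal_minimal[OF zeroideal, of "{}"]
      additive_subgroup.zero_closed[OF ideal.axioms(1)[OF genideal_ideal[of "{}"]]] by auto
  ultimately have "regular_sequence R [?x]"
    using x by (simp add: regular_sequence_def)
  then show "1 \<in> {enat (length xs) |xs. regular_sequence R xs \<and> set xs \<subseteq> max_ideal}"
    using t_power_in_max_ideal by (intro CollectI exI[of _ "[?x]"]) (simp add: one_enat_def)
next
  fix d assume "d \<in> {enat (length xs) |xs. regular_sequence R xs \<and> set xs \<subseteq> max_ideal}"
  then obtain xs where d: "d = enat (length xs)" and xs: "regular_sequence R xs" "set xs \<subseteq> max_ideal"
    by blast
  have "length xs \<le> 1"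
  proof (rule ccontr)
    assume "\<not> length xs \<le> 1"
    then obtain x y zs where e: "xs = x # y # zs"
      by (metis One_nat_def le_numeral_extra(4) length_0_conv length_Cons list.exhaust zero_le)
    have xy: "x \<in> carrier R" "y \<in> carrier R" "y \<in> max_ideal"
      using xs e by (auto simp: max_ideal_def)
    have idl: "ideal (Idl (set xs)) R" "ideal (Idl {x}) R"
      using xs(1) xy by (auto intro!: genideal_ideal simp: regular_sequence_def)
    have sub: "Idl {x} \<subseteq> Idl (set xs)"
      using xs(1) e by (intro subset_Idl_subset) (auto simp: regular_sequence_def)
    have notone: "1 \<notin> Idl (set xs)"
      using ideal.one_imp_carrier[OF idl(1)] xs(1) by (auto simp: regular_sequence_def)
    have reg: "xs ! i \<otimes> a \<in> Idl (set (take i xs)) \<Longrightarrow> a \<in> Idl (set (take i xs))"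
      if "i < length xs" "a \<in> carrier R" for i a
      using xs(1) that unfolding regular_sequence_def by blast
    have "Idl {} = {0}" using genideal_minimal[OF zeroideal, of "{}"]
      additive_subgroup.zero_closed[OF ideal.axioms(1)[OF genideal_ideal[of "{}"]]] by auto
    then have x0: "x \<noteq> 0" using reg[of 0 1] one_closed e by auto
    have x_in: "x \<in> Idl {x}" using genideal_self'[OF xy(1)] .
    have "y ^ n \<in> Idl {x} \<Longrightarrow> 1 \<in> Idl {x}" for n
    proof (induction n)
      case (Suc n)
      have "y [^] n \<in> carrier R" using xy by (intro nat_pow_closed)
      then have "y ^ n \<in> Idl {x}" using reg[of 1 "y ^ n"] Suc.prems e by simp
      then show ?case by (rule Suc.IH)
    qed simp
    then show False using power_in_ideal[OF idl(2) x_in x0 xy(3)] sub notone by blast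
  qed
  then show "d \<le> 1" by (simp add: d one_enat_def)
qed

text \<open>Choose for each order below a bound an element of the ideal with that order, if there
  is one.  Subtracting multiples of these cancels the coefficients of any element of the
  ideal up to the bound, and what is left is a multiple of a fixed nonzero \<open>x\<close>.\<close>

lemma noetherian: "noetherian_ring R"
proof (rule noetherian_ringI)
  fix J assume J: "ideal J R"
  interpret J: ideal J R by (rule J)
  show "\<exists>S\<subseteq>carrier R. finite S \<and> J = Idl S"
  proof (cases "J = {0}")
    case True
    then show ?thesis using genideal_zero by (intro exI[of _ "{0}"]) (auto simp: carrier_iff)
  next
    case False
    then obtain x where x: "x \<in> J" "x \<noteq> 0"
      using J.zero_closed by auto
    define V where "V = {m. m < subdegree x + c \<and> (\<exists>F\<in>J. F \<noteq> 0 \<and> subdegree F = m)}"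
    define e where "e m = (SOME F. F \<in> J \<and> F \<noteq> 0 \<and> subdegree F = m)" for m
    have e: "e m \<in> J \<and> e m \<noteq> 0 \<and> subdegree (e m) = m" if "m \<in> V" for m
      unfolding e_def by (rule someI_ex) (use that in \<open>auto simp: V_def\<close>)
    let ?S = "insert x (e ` V)"
    have S: "?S \<subseteq> J" "?S \<subseteq> carrier R" using e x J.Icarr by auto
    have idl: "ideal (Idl ?S) R" by (rule genideal_ideal[OF S(2)])
    have SI: "?S \<subseteq> Idl ?S" by (rule genideal_self[OF S(2)])
    have sub: "Idl ?S \<subseteq> J" by (rule genideal_minimal[OF J S(1)])
    have approx: "\<exists>G\<in>Idl ?S. \<forall>i<m. fps_nth (F - G) i = 0"
      if F: "F \<in> J" and "m \<le> subdegree x + c" for F m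
      using that(2)
    proof (induction m)
      case 0
      have "0 \<in> Idl ?S" using additive_subgroup.zero_closed[OF ideal.axioms(1)[OF idl]] by simp
      then show ?case by blast
    next
      case (Suc m)
      then obtain G where G: "G \<in> Idl ?S" "\<forall>i<m. fps_nth (F - G) i = 0" by auto
      show ?case
      proof (cases "fps_nth (F - G) m = 0")
        case True
        then show ?thesis using G less_Suc_eq by (intro bexI[of _ G]) auto
      next
        case False
        then have "subdegree (F - G) = m" using G(2) by (intro subdegreeI) auto
        moreover have "F - G \<in> J" using ideal_minus[OF J F] G(1) sub by blast
        moreover have "F - G \<noteq> 0" using False by auto
        moreover have "m < subdegree x + c" using Suc.prems by simp
        ultimately have m: "m \<in> V" unfolding V_def by blast
        define q where "q = fps_nth (F - G) m / fps_nth (e m) m"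
        have em: "fps_nth (e m) m \<noteq> 0" using e[OF m] nth_subdegree_nonzero[of "e m"] by auto
        have em0: "fps_nth (e m) i = 0" if "i < m" for i
          using e[OF m] that by (intro nth_less_subdegree_zero) simp
        have "e m \<in> Idl ?S" using SI m by blast
        then have "G + fps_const q * e m \<in> Idl ?S"
          by (rule ideal_plus[OF idl G(1) ideal_times[OF idl _ const_closed]])
        moreover have "fps_nth (F - (G + fps_const q * e m)) i = 0" if "i < Suc m" for i
          using that G(2) em em0 by (cases "i = m") (auto simp: q_def)
        ultimately show ?thesis by blast
      qed
    qed
    have "J \<subseteq> Idl ?S"
    proof
      fix F assume "F \<in> J"
      then obtain G where G: "G \<in> Idl ?S" "\<forall>i<subdegree x + c. fps_nth (F - G) i = 0"
        using approx by blast
      have "F - G \<in> Idl ?S"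
        using high_order_in_ideal[OF idl _ x(2) G(2)] SI by blast
      then have "(F - G) + G \<in> Idl ?S" using ideal_plus[OF idl] G(1) by blast
      then show "F \<in> Idl ?S" by simp
    qed
    then have "J = Idl ?S" using sub by blast
    moreover have "finite ?S" by (simp add: V_def)
    ultimately show ?thesis using S(2) by (intro exI[of _ ?S] conjI)
  qed
qed

lemma cohen_macaulay: "cohen_macaulay_local R max_ideal"
  unfolding cohen_macaulay_local_def
  using noetherian local_ring depth_eq_1 krull_dim_eq_1 by simp

end

section \<open>The Ulrich ideals\<close>

lemma mem_semigroup_5_11_iff: "n \<in> semigroup_generated2 5 11 \<longleftrightarrow> 11 * (n mod 5) \<le> n"
proof
  assume "n \<in> semigroup_generated2 5 11"
  then obtain a b where n: "n = a * 5 + b * 11" by (auto simp: semigroup_generated2_def)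
  have "n mod 5 = (b * 11) mod 5" unfolding n by simp
  also have "\<dots> = b mod 5" by presburger
  finally have "n mod 5 \<le> b" by simp
  then show "11 * (n mod 5) \<le> n" unfolding n by linarith
next
  assume le: "11 * (n mod 5) \<le> n"
  define d r where "d = n div 5" and "r = n mod 5"
  have n: "n = 5 * d + r" by (simp add: d_def r_def)
  have "11 * r \<le> n" using le by (simp add: r_def)
  then have "11 * r \<le> 5 * d + r" by (simp add: n)
  then have "n = (d - 2 * r) * 5 + r * 11" unfolding n by (simp add: diff_mult_distrib)
  then show "n \<in> semigroup_generated2 5 11" unfolding semigroup_generated2_def by blast
qed

lemma numerical_semigroup_ring_5_11:
  "numerical_semigroup_ring (semigroup_generated2 5 11) 40 A_5_11"
proof
  show "m + n \<in> semigroup_generated2 5 11"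
    if mn: "m \<in> semigroup_generated2 5 11" "n \<in> semigroup_generated2 5 11" for m n
  proof -
    obtain a b a' b' where "m = a * 5 + b * 11" "n = a' * 5 + b' * 11"
      using mn unfolding semigroup_generated2_def by blast
    then have "m + n = (a + a') * 5 + (b + b') * 11" by (simp add: algebra_simps)
    then show ?thesis unfolding semigroup_generated2_def by blast
  qed
  show "n \<in> semigroup_generated2 5 11" if "40 \<le> n" for n
  proof (cases "44 \<le> n")
    case True
    have "n mod 5 \<le> 4" by simp
    then show ?thesis using True unfolding mem_semigroup_5_11_iff by linarith
  next
    case False
    then have "n = 40 \<or> n = 41 \<or> n = 42 \<or> n = 43" using that by linarith
    then show ?thesis unfolding mem_semigroup_5_11_iff by auto
  qed
qed (simp_all add: mem_semigroup_5_11_iff)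

locale ulrich_5_11 = numerical_semigroup_ring "semigroup_generated2 5 11" 40 R
  for R :: "'k::field fps ring" (structure) +
  fixes a1 a2 a3 :: 'k
  assumes a1_nonzero: "a1 \<noteq> 0"
begin

abbreviation f :: "'k fps" where "f \<equiv> ulrich_f a1 a2 a3"
abbreviation g :: "'k fps" where "g \<equiv> ulrich_g"
abbreviation I :: "'k fps set" where "I \<equiv> Idl {f, g}"

text \<open>Most coefficient computations below end by noticing that some exponent is a gap of the
  semigroup.\<close>

lemma nth_gap: "F \<in> carrier R \<Longrightarrow> \<not> 11 * (n mod 5) \<le> n \<Longrightarrow> fps_nth F n = 0"
  unfolding carrier_iff mem_semigroup_5_11_iff by blast

lemma f_nth: "fps_nth f n = (if n = 10 then 1 else if n = 11 then a1 else if n = 16 then a2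
    else if n = 22 then a3 else 0)"
  by (simp add: ulrich_f_def)

lemma f_times_nth:
  "fps_nth (f * F) n = (if n < 10 then 0 else fps_nth F (n - 10))
    + a1 * (if n < 11 then 0 else fps_nth F (n - 11))
    + a2 * (if n < 16 then 0 else fps_nth F (n - 16))
    + a3 * (if n < 22 then 0 else fps_nth F (n - 22))"
  by (simp add: ulrich_f_def distrib_right mult.assoc fps_X_power_mult_nth)

lemma g_times_nth: "fps_nth (g * F) n = (if n < 27 then 0 else fps_nth F (n - 27))"
  by (simp add: ulrich_g_def fps_X_power_mult_nth)

lemma f_closed: "f \<in> carrier R"
  by (auto simp: carrier_iff mem_semigroup_5_11_iff f_nth split: if_splits)

lemma g_closed: "g \<in> carrier R"
  unfolding ulrich_g_def by (rule power_of_t_closed) (simp add: mem_semigroup_5_11_iff)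

lemma f_nonzero: "f \<noteq> 0"
  using f_nth[of 10] by auto

lemma subdegree_f: "subdegree f = 10"
  by (rule subdegreeI) (auto simp: f_nth)

lemma I_ideal: "ideal I R"
  using f_closed g_closed by (intro genideal_ideal) simp

lemma f_in_I: "f \<in> I" and g_in_I: "g \<in> I"
  using genideal_self[of "{f, g}"] f_closed g_closed by auto

lemma I_elems: "F \<in> I \<longleftrightarrow> (\<exists>a\<in>carrier R. \<exists>b\<in>carrier R. F = a * f + b * g)"
  unfolding genideal_pair[OF f_closed g_closed] by blast

lemma t_power_times_g_in_I:
  assumes "s \<in> semigroup_generated2 5 11"
  shows "fps_X ^ (s + 27) \<in> I"
  using ideal_times[OF I_ideal g_in_I power_of_t_closed[OF assms]]
  by (simp add: ulrich_g_def flip: power_add)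

lemma t_power_times_f_in_I:
  assumes "s \<in> semigroup_generated2 5 11"
  shows "fps_X ^ (s + 10) + fps_const a1 * fps_X ^ (s + 11)
    + fps_const a2 * fps_X ^ (s + 16) + fps_const a3 * fps_X ^ (s + 22) \<in> I"
proof -
  have "fps_X ^ s * f \<in> I"
    by (rule ideal_times[OF I_ideal f_in_I power_of_t_closed[OF assms]])
  also have "fps_X ^ s * f = fps_X ^ (s + 10) + fps_const a1 * fps_X ^ (s + 11)
    + fps_const a2 * fps_X ^ (s + 16) + fps_const a3 * fps_X ^ (s + 22)"
    by (simp add: ulrich_f_def power_add distrib_left mult.left_commute)
  finally show ?thesis .
qed

text \<open>The multiple \<open>t\<^sup>s f\<close> has four terms, so it puts a power of \<open>t\<close> into \<open>I\<close> once the other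
  three are there.  Solving for the leading term is always possible; solving for the second
  one, as the next lemma does, divides by \<open>\<alpha>\<^sub>1\<close>.\<close>

lemma leading_t_power_in_I:
  assumes s: "s \<in> semigroup_generated2 5 11"
    and "fps_X ^ (s + 11) \<in> I" "fps_X ^ (s + 16) \<in> I" "fps_X ^ (s + 22) \<in> I"
  shows "fps_X ^ (s + 10) \<in> I"
proof -
  let ?p = "fps_X ^ (s + 10) + fps_const a1 * fps_X ^ (s + 11)
    + fps_const a2 * fps_X ^ (s + 16) + fps_const a3 * fps_X ^ (s + 22)"
  have "?p - fps_const a3 * fps_X ^ (s + 22) - fps_const a2 * fps_X ^ (s + 16)
      - fps_const a1 * fps_X ^ (s + 11) \<in> I"
    using assms(2-4) t_power_times_f_in_I[OF s]
    by (intro ideal_minus[OF I_ideal] ideal_times[OF I_ideal] const_closed)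
  then show ?thesis by (simp only: add_diff_cancel_right')
qed

lemma second_t_power_in_I:
  assumes s: "s \<in> semigroup_generated2 5 11"
    and "fps_X ^ (s + 10) \<in> I" "fps_X ^ (s + 16) \<in> I" "fps_X ^ (s + 22) \<in> I"
  shows "fps_X ^ (s + 11) \<in> I"
proof -
  let ?p = "fps_X ^ (s + 10) + fps_const a1 * fps_X ^ (s + 11)
    + fps_const a2 * fps_X ^ (s + 16) + fps_const a3 * fps_X ^ (s + 22)"
  have "?p - fps_const a3 * fps_X ^ (s + 22) - fps_const a2 * fps_X ^ (s + 16)
      - fps_X ^ (s + 10) \<in> I"
    using assms(2-4) t_power_times_f_in_I[OF s]
    by (intro ideal_minus[OF I_ideal] ideal_times[OF I_ideal] const_closed)
  then have "fps_const a1 * fps_X ^ (s + 11) \<in> I"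
    by (simp only: add_diff_cancel_right' add_diff_cancel_left')
  then have "fps_const (inverse a1) * (fps_const a1 * fps_X ^ (s + 11)) \<in> I"
    by (rule ideal_times[OF I_ideal _ const_closed])
  also have "fps_const (inverse a1) * (fps_const a1 * fps_X ^ (s + 11)) = fps_X ^ (s + 11)"
    unfolding mult.assoc[symmetric] fps_const_mult using a1_nonzero by simp
  finally show ?thesis .
qed

text \<open>Descending over the residue modulo 5: the exponents in \<open>27 + H\<close> come from \<open>g\<close>, then those
  congruent to 1 and to 0 from the leading term of a multiple of \<open>f\<close>.  The exponents 33 and
  44 are the only ones that remain; both occur as the second term of a multiple
  of \<open>f\<close>, namely of \<open>t\<^sup>2\<^sup>2 f\<close> and \<open>t\<^sup>3\<^sup>3 f\<close>, and this is where \<open>\<alpha>\<^sub>1 \<noteq> 0\<close> is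
  needed.\<close>

lemma t_power_in_I:
  assumes n: "25 \<le> n" "11 * (n mod 5) \<le> n"
  shows "fps_X ^ n \<in> I"
proof -
  have H: "a * 5 + b * 11 \<in> semigroup_generated2 5 11" for a b
    by (auto simp: semigroup_generated2_def)
  have r2: "fps_X ^ (27 + 5 * k) \<in> I" for k
    using t_power_times_g_in_I[OF H[of k 0]] by (simp add: algebra_simps)
  have r3: "fps_X ^ (38 + 5 * k) \<in> I" for k
    using t_power_times_g_in_I[OF H[of k 1]] by (simp add: algebra_simps)
  have r4: "fps_X ^ (49 + 5 * k) \<in> I" for k
    using t_power_times_g_in_I[OF H[of k 2]] by (simp add: algebra_simps)
  have r1: "fps_X ^ (26 + 5 * k) \<in> I" for k
    using leading_t_power_in_I[OF H[of "k + 1" 1]] r2[of k] r2[of "k + 1"] r3[of k]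
    by (simp add: algebra_simps)
  have r0: "fps_X ^ (25 + 5 * k) \<in> I" for k
    using leading_t_power_in_I[OF H[of "k + 3" 0]] r1[of k] r1[of "k + 1"] r2[of "k + 2"]
    by (simp add: algebra_simps)
  have t44: "fps_X ^ 44 \<in> I"
    using second_t_power_in_I[OF H[of 0 3]] r3[of 1] r4[of 0] r0[of 6] by simp
  have t33: "fps_X ^ 33 \<in> I"
    using second_t_power_in_I[OF H[of 0 2]] r2[of 1] r3[of 0] t44 by simp
  define d r where "d = n div 5" and "r = n mod 5"
  have nd: "n = 5 * d + r" and "r < 5" by (simp_all add: d_def r_def)
  have le: "25 \<le> 5 * d + r" "11 * r \<le> 5 * d + r" using n unfolding r_def[symmetric] by (simp_all flip: nd)
  consider "r = 0" | "r = 1" | "r = 2" | "r = 3" | "r = 4" using \<open>r < 5\<close> by linarith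
  then show ?thesis
  proof cases
    assume "r = 0"
    then have "n = 25 + 5 * (d - 5)" using nd le by simp
    then show ?thesis using r0 by metis
  next
    assume "r = 1"
    then have "n = 26 + 5 * (d - 5)" using nd le by simp
    then show ?thesis using r1 by metis
  next
    assume "r = 2"
    then have "n = 27 + 5 * (d - 5)" using nd le by simp
    then show ?thesis using r2 by metis
  next
    assume "r = 3"
    then have "n = 33 \<or> n = 38 + 5 * (d - 7)" using nd le by (cases "d = 6") simp_all
    then show ?thesis using r3 t33 by metis
  next
    assume "r = 4"
    then have "n = 44 \<or> n = 49 + 5 * (d - 9)" using nd le by (cases "d = 8") simp_all
    then show ?thesis using r4 t44 by metis
  qed
qed

text \<open>The powers of \<open>t\<close> account for a polynomial part; from order 50 on, which is the order of
  \<open>f\<close> plus the conductor, everything is a multiple of \<open>f\<close>.\<close>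

lemma order_25_in_I:
  assumes F: "F \<in> carrier R" "\<forall>i<25. fps_nth F i = 0"
  shows "F \<in> I"
proof -
  let ?P = "\<Sum>i\<in>{25..<50}. fps_const (fps_nth F i) * fps_X ^ i"
  have "?P \<in> I"
  proof (rule ideal_sum[OF I_ideal])
    fix i assume i: "i \<in> {25..<50::nat}"
    show "fps_const (fps_nth F i) * fps_X ^ i \<in> I"
    proof (cases "fps_nth F i = 0")
      case True
      then show ?thesis using additive_subgroup.zero_closed[OF ideal.axioms(1)[OF I_ideal]] by simp
    next
      case False
      then have "fps_X ^ i \<in> I" using t_power_in_I[of i] nth_gap[OF F(1)] i by auto
      then show ?thesis by (rule ideal_times[OF I_ideal _ const_closed])
    qed
  qed simp
  moreover have "F - ?P \<in> I"
  proof (rule high_order_in_ideal[OF I_ideal f_in_I f_nonzero], intro allI impI)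
    fix j assume "j < subdegree f + 40"
    then have j: "j < 50" by (simp add: subdegree_f)
    have "fps_nth ?P j = (\<Sum>i\<in>{25..<50}. if i = j then fps_nth F j else 0)"
      unfolding fps_sum_nth by (rule sum.cong) auto
    also have "\<dots> = fps_nth F j" using F(2) j by (simp add: sum.delta)
    finally show "fps_nth (F - ?P) j = 0" by simp
  qed
  ultimately have "(F - ?P) + ?P \<in> I" using ideal_plus[OF I_ideal] by blast
  then show ?thesis by simp
qed

text \<open>Since \<open>I = fA\<close> plus all series in \<open>A\<close> of order at least 25, membership is a finite
  linear condition: the coefficients of \<open>F\<close> at the exponents 10, 15, 20, 21 determine the
  multiplier \<open>p\<close> with \<open>F - pf\<close> of order at least 25, and the other five exponents of \<open>H\<close>
  below 25 give five equations.  So \<open>1, t\<^sup>5, t\<^sup>1\<^sup>1, t\<^sup>1\<^sup>6, t\<^sup>2\<^sup>2\<close> is a basis of \<open>A/I\<close>.\<close>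

lemma mem_I_iff:
  "F \<in> I \<longleftrightarrow> F \<in> carrier R \<and> fps_nth F 0 = 0 \<and> fps_nth F 5 = 0 \<and>
     fps_nth F 11 = a1 * fps_nth F 10 \<and>
     fps_nth F 16 = a2 * fps_nth F 10 + a1 * fps_nth F 15 \<and>
     fps_nth F 22 = a3 * fps_nth F 10
       + a1 * (fps_nth F 21 - a1 * fps_nth F 20 - a2 * fps_nth F 15)"
  (is "_ \<longleftrightarrow> ?R F")
proof
  assume "F \<in> I"
  then obtain a b where ab: "a \<in> carrier R" "b \<in> carrier R" and F: "F = f * a + g * b"
    unfolding I_elems by (auto simp: mult.commute)
  have "F \<in> carrier R" using \<open>F \<in> I\<close> ideal.Icarr[OF I_ideal] by blast
  have F_nth: "fps_nth F n = fps_nth (f * a) n" if "n < 27" for n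
    using that by (simp add: F g_times_nth)
  note az = nth_gap[OF ab(1)]
  have "fps_nth F 0 = 0" "fps_nth F 5 = 0" "fps_nth F 10 = fps_nth a 0"
    by (simp_all add: F_nth f_times_nth del: fps_mult_nth_0)
  moreover have "fps_nth F 11 = a1 * fps_nth a 0" "fps_nth F 15 = fps_nth a 5"
      "fps_nth F 16 = a1 * fps_nth a 5 + a2 * fps_nth a 0" "fps_nth F 20 = fps_nth a 10"
    using az[of 1] az[of 4] az[of 6] az[of 9] by (simp_all add: F_nth f_times_nth)
  moreover have "fps_nth F 21 = fps_nth a 11 + a1 * fps_nth a 10 + a2 * fps_nth a 5"
      "fps_nth F 22 = a1 * fps_nth a 11 + a3 * fps_nth a 0"
    using az[of 12] az[of 6] by (simp_all add: F_nth f_times_nth)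
  ultimately show "?R F" using \<open>F \<in> carrier R\<close> by (simp add: algebra_simps)
next
  assume R: "?R F"
  define p where "p = fps_const (fps_nth F 10) + fps_const (fps_nth F 15) * fps_X ^ 5
    + fps_const (fps_nth F 20) * fps_X ^ 10
    + fps_const (fps_nth F 21 - a1 * fps_nth F 20 - a2 * fps_nth F 15) * fps_X ^ 11"
  have p: "p \<in> carrier R"
    unfolding p_def
    by (intro add_closed times_closed const_closed power_of_t_closed)
      (simp_all add: mem_semigroup_5_11_iff)
  have pn: "fps_nth p n = (if n = 0 then fps_nth F 10 else if n = 5 then fps_nth F 15
      else if n = 10 then fps_nth F 20
      else if n = 11 then fps_nth F 21 - a1 * fps_nth F 20 - a2 * fps_nth F 15 else 0)" for n
    by (simp add: p_def)
  have G: "F - f * p \<in> carrier R"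
    using R p f_closed by (intro diff_closed times_closed) auto
  moreover have "\<forall>i<25. fps_nth (F - f * p) i = 0"
  proof (intro allI impI)
    fix i :: nat assume "i < 25"
    then have "i \<in> {..<25}" by simp
    show "fps_nth (F - f * p) i = 0"
    proof (cases "11 * (i mod 5) \<le> i")
      case False
      then show ?thesis using nth_gap[OF G] by blast
    next
      case True
      then have "i \<in> {0, 5, 10, 11, 15, 16, 20, 21, 22}"
        using \<open>i \<in> {..<25}\<close> by (auto simp add: lessThan_nat_numeral simp del: lessThan_iff)
      then consider "i = 0 \<or> i = 5 \<or> i = 10 \<or> i = 15 \<or> i = 20 \<or> i = 21"
        | "i = 11" | "i = 16" | "i = 22" by blast
      then show ?thesis
      proof cases
        case 1
        then show ?thesis using R by (elim disjE) (simp_all add: f_times_nth pn del: fps_mult_nth_0)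
      qed (use R in \<open>simp_all add: f_times_nth pn\<close>)
    qed
  qed
  ultimately have "F - f * p \<in> I" by (rule order_25_in_I)
  moreover have "p * f \<in> I" by (rule ideal_times[OF I_ideal f_in_I p])
  ultimately have "(F - f * p) + p * f \<in> I" using ideal_plus[OF I_ideal] by blast
  then show "F \<in> I" by (simp add: mult.commute)
qed

text \<open>The inclusion \<open>(fA : g) \<subseteq> I\<close>.  Comparing coefficients in \<open>gb = fq\<close>, where those of \<open>b\<close>
  and \<open>q\<close> vanish at the gaps of \<open>H\<close>, expresses the relevant coefficients of \<open>b\<close> through
  those of \<open>q\<close> at 27, 32, 37 and 38, and they satisfy the equations of \<open>I\<close>.\<close>

lemma colon_subset_I:
  assumes b: "b \<in> carrier R" and q: "q \<in> carrier R" and eq: "g * b = f * q"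
  shows "b \<in> I"
proof -
  note bz = nth_gap[OF b] and qz = nth_gap[OF q]
  have E: "fps_nth (f * q) n = (if n < 27 then 0 else fps_nth b (n - 27))" for n
    unfolding eq[symmetric] g_times_nth ..
  note E = E[unfolded f_times_nth]
  have q0: "fps_nth q 0 = 0" using E[of 10] by simp
  have q5: "fps_nth q 5 = 0" using E[of 15] qz[of 4] by simp
  have q10: "fps_nth q 10 = 0" using E[of 20] qz[of 9] qz[of 4] by simp
  have q11: "fps_nth q 11 = 0" using E[of 21] q10 q5 by simp
  have q15: "fps_nth q 15 = 0" using E[of 25] qz[of 14] qz[of 9] qz[of 3] by simp
  have q16: "fps_nth q 16 = 0" using E[of 26] q15 q10 qz[of 4] by simp
  have q20: "fps_nth q 20 = 0" using E[of 30] qz[of 19] qz[of 14] qz[of 8] bz[of 3] by simp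
  have q21: "fps_nth q 21 = 0" using E[of 31] q20 q15 qz[of 9] bz[of 4] by simp
  \<comment> \<open>Here, and for the coefficient at 33 below, only the term with factor \<open>\<alpha>\<^sub>1\<close> survives.\<close>
  have q22: "fps_nth q 22 = 0"
    using E[of 33] qz[of 23] qz[of 17] q11 bz[of 6] a1_nonzero by simp
  have q25: "fps_nth q 25 = 0" using E[of 35] qz[of 24] qz[of 19] qz[of 13] bz[of 8] by simp
  have q26: "fps_nth q 26 = 0" using E[of 36] q25 q20 qz[of 14] bz[of 9] by simp
  have q30: "fps_nth q 30 = 0" using E[of 40] qz[of 29] qz[of 24] qz[of 18] bz[of 13] by simp
  have q31: "fps_nth q 31 = 0" using E[of 41] q30 q25 qz[of 19] bz[of 14] by simp
  have q33: "fps_nth q 33 = 0"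
    using E[of 44] qz[of 34] qz[of 28] q22 bz[of 17] a1_nonzero by simp
  have q35: "fps_nth q 35 = 0" using E[of 45] qz[of 34] qz[of 29] qz[of 23] bz[of 18] by simp
  have q36: "fps_nth q 36 = 0" using E[of 46] q35 q30 qz[of 24] bz[of 19] by simp
  have b0: "fps_nth b 0 = 0" using E[of 27] qz[of 17] q16 q11 q5 by simp
  have b5: "fps_nth b 5 = 0" using E[of 32] q22 q21 q16 q10 by simp
  have b10: "fps_nth b 10 = fps_nth q 27" using E[of 37] q26 q21 q15 by simp
  have b11: "fps_nth b 11 = a1 * fps_nth q 27" using E[of 38] qz[of 28] q22 q16 by simp
  have b15: "fps_nth b 15 = fps_nth q 32" using E[of 42] q31 q26 q20 by simp
  have b16: "fps_nth b 16 = a1 * fps_nth q 32 + a2 * fps_nth q 27"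
    using E[of 43] q33 q21 by simp
  have b20: "fps_nth b 20 = fps_nth q 37" using E[of 47] q36 q31 q25 by simp
  have b21: "fps_nth b 21 = fps_nth q 38 + a1 * fps_nth q 37 + a2 * fps_nth q 32"
    using E[of 48] q26 by simp
  have b22: "fps_nth b 22 = a1 * fps_nth q 38 + a3 * fps_nth q 27"
    using E[of 49] qz[of 39] q33 by simp
  show ?thesis
    unfolding mem_I_iff using b b0 b5 b10 b11 b15 b16 b20 b21 b22 by (simp add: algebra_simps)
qed

lemma one_notin_I: "1 \<notin> I"
  by (simp add: mem_I_iff)

text \<open>\<open>g\<^sup>2/f\<close> has order \<open>54 - 10 = 44\<close>, which is beyond the conductor and beyond 25.\<close>

lemma g_square: "\<exists>h\<in>I. g * g = f * h"
proof -
  have nth: "fps_nth (g * g) i = (if i = 54 then 1 else 0)" for i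
    by (simp add: ulrich_g_def flip: power_add)
  obtain h where h: "h \<in> carrier R" "g * g = f * h"
    using high_order_multiple[OF f_nonzero, of "g * g"] by (auto simp: subdegree_f nth)
  have "g * g \<noteq> 0" using nth[of 54] by auto
  then have "subdegree (g * g) = 10 + subdegree h"
    unfolding h(2) by (subst subdegree_mult) (auto simp: subdegree_f)
  moreover have "subdegree (g * g) = 54" by (rule subdegreeI) (simp_all add: nth)
  ultimately have "\<forall>i<25. fps_nth h i = 0" by (auto intro!: nth_less_subdegree_zero)
  then show ?thesis using order_25_in_I h by blast
qed

lemma square_elems:
  assumes "F \<in> I \<cdot> I"
  shows "\<exists>h\<in>I. F = f * h"
  using assms
proof (induction F rule: ideal_prod.induct)
  case (prod i j)
  obtain a b where i: "a \<in> carrier R" "b \<in> carrier R" "i = a * f + b * g"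
    using prod(1) I_elems by blast
  obtain c d where j: "c \<in> carrier R" "d \<in> carrier R" "j = c * f + d * g"
    using prod(2) I_elems by blast
  obtain h where h: "h \<in> I" "g * g = f * h" using g_square by blast
  have "a * j + (b * c) * g + (b * d) * h \<in> I"
    using i j h prod(2) g_in_I
    by (intro ideal_plus[OF I_ideal] ideal_times[OF I_ideal] times_closed)
  moreover have "i \<otimes> j = f * (a * j + (b * c) * g) + (b * d) * (g * g)"
    unfolding i(3) j(3) ring_operations by (simp add: algebra_simps)
  then have "i \<otimes> j = f * (a * j + (b * c) * g + (b * d) * h)"
    unfolding h(2) by (simp add: algebra_simps)
  ultimately show ?case by blast
next
  case (sum s1 s2)
  then obtain h1 h2 where "h1 \<in> I" "h2 \<in> I" "s1 = f * h1" "s2 = f * h2" by blast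
  then have "h1 + h2 \<in> I" "s1 \<oplus> s2 = f * (h1 + h2)"
    using ideal_plus[OF I_ideal] by (auto simp: algebra_simps)
  then show ?case by blast
qed

lemma square_eq: "I \<cdot> I = (PIdl f) \<cdot> I"
proof
  have "f * h \<in> (PIdl f) \<cdot> I" if "h \<in> I" for h
    using ideal_prod.prod[of f "PIdl f" h I R] cgenideal_self[OF f_closed] that by simp
  then show "I \<cdot> I \<subseteq> (PIdl f) \<cdot> I" using square_elems by blast
  have "PIdl f \<subseteq> I" by (rule cgenideal_minimal[OF I_ideal f_in_I])
  show "(PIdl f) \<cdot> I \<subseteq> I \<cdot> I"
  proof
    fix F assume "F \<in> (PIdl f) \<cdot> I"
    then show "F \<in> I \<cdot> I"
      by induction (use \<open>PIdl f \<subseteq> I\<close> in \<open>blast intro: ideal_prod.intros\<close>)+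
  qed
qed

text \<open>With \<open>af + bg = fh\<close> for some \<open>h \<in> I\<close>, the element \<open>bg\<close> is a multiple of \<open>f\<close>, so \<open>b \<in> I\<close>
  by the colon computation.  Then \<open>bg \<in> I\<^sup>2\<close>, hence \<open>af \<in> I\<^sup>2 = fI\<close>, and cancelling \<open>f\<close>
  gives \<open>a \<in> I\<close>.\<close>

lemma relations_in_I:
  assumes a: "a \<in> carrier R" and b: "b \<in> carrier R" and ab: "a * f + b * g \<in> I \<cdot> I"
  shows "a \<in> I \<and> b \<in> I"
proof -
  interpret II: ideal "I \<cdot> I" R by (rule ideal_prod_is_ideal[OF I_ideal I_ideal])
  obtain h where h: "h \<in> I" "a * f + b * g = f * h" using square_elems[OF ab] by blast
  have "g * b = f * (h - a)" using h(2) by (simp add: algebra_simps)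
  then have bI: "b \<in> I"
    using colon_subset_I[OF b] diff_closed[OF _ a] ideal.Icarr[OF I_ideal h(1)] by blast
  then have "b * g \<in> I \<cdot> I" using ideal_prod.prod[of b I g I R] g_in_I by simp
  then have "(a * f + b * g) - b * g \<in> I \<cdot> I"
    using ideal_minus[OF II.ideal_axioms ab] by blast
  then have "a * f \<in> I \<cdot> I" by (simp only: add_diff_cancel_right')
  then obtain h' where "h' \<in> I" "a * f = f * h'" using square_elems by blast
  then have "a \<in> I" using f_nonzero by (simp add: mult.commute)
  then show ?thesis using bI by blast
qed

lemma ulrich: "ulrich_ideal R I"
  unfolding ulrich_ideal_def
proof (intro exI[of _ max_ideal] conjI bexI[of _ f])
  have proper: "I \<noteq> carrier R" using one_notin_I one_closed by auto
  have Q: "ideal (PIdl f) R" by (rule cgenideal_ideal[OF f_closed])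
  have QI: "PIdl f \<subseteq> I" by (rule cgenideal_minimal[OF I_ideal f_in_I])
  have fQ: "f \<in> PIdl f" by (rule cgenideal_self[OF f_closed])
  show "cohen_macaulay_local R max_ideal" "krull_dim R = 1"
    by (rule cohen_macaulay krull_dim_eq_1)+
  show "m_primary R max_ideal I"
    by (rule proper_nonzero_ideal_m_primary[OF I_ideal proper f_in_I f_nonzero])
  have "PIdl f \<noteq> carrier R"
    using QI one_notin_I one_closed by auto
  then show "m_primary R max_ideal (PIdl f)"
    by (rule proper_nonzero_ideal_m_primary[OF Q _ fQ f_nonzero])
  \<comment> \<open>The exponent \<open>n = 1\<close> witnesses the reduction: \<open>I\<^sup>2 = QI\<close>.\<close>
  have "I [^]\<^bsub>ideals_set R\<^esub> (1::nat) = carrier R \<cdot> I"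
    by (simp add: nat_pow_def ideals_set_def)
  also have "\<dots> = I" using ideal_prod_commute[OF oneideal I_ideal] ideal_prod_one[OF I_ideal] by simp
  finally have p1: "I [^]\<^bsub>ideals_set R\<^esub> (1::nat) = I" .
  have "I [^]\<^bsub>ideals_set R\<^esub> Suc 1 = (I [^]\<^bsub>ideals_set R\<^esub> (1::nat)) \<cdot> I"
    by (simp add: nat_pow_def ideals_set_def)
  then have "I [^]\<^bsub>ideals_set R\<^esub> Suc 1 = (PIdl f) \<cdot> (I [^]\<^bsub>ideals_set R\<^esub> (1::nat))"
    unfolding p1 square_eq .
  then show "reduction R (PIdl f) I"
    unfolding reduction_def using Q I_ideal QI by blast
  show "I \<noteq> PIdl f"
  proof
    assume "I = PIdl f"
    \<comment> \<open>Then \<open>g \<in> fA\<close>, so \<open>1\<close> lies in the colon ideal \<open>(fA : g)\<close>.\<close>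
    then obtain q where "q \<in> carrier R" "g = q * f"
      using g_in_I unfolding cgenideal_def by auto
    then have "1 \<in> I" using colon_subset_I[of 1 q] one_closed by (simp add: mult.commute)
    then show False using one_notin_I by blast
  qed
  show "I \<cdot> I = (PIdl f) \<cdot> I" by (rule square_eq)
  show "free_module (R Quot I) (ideal_mod_square R I)"
    by (rule free_ideal_mod_square_of_two_generators[OF I_ideal _ f_in_I g_in_I])
      (use one_notin_I I_elems relations_in_I in auto)
qed (rule f_closed)

text \<open>For a series of the form of \<open>f\<close> the equations that describe \<open>I\<close> at the exponents 11, 16
  and 22 read off the three parameters of \<open>I\<close>.\<close>

lemma parameters_unique:
  assumes "ulrich_f b1 b2 b3 \<in> I"
  shows "b1 = a1 \<and> b2 = a2 \<and> b3 = a3"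
  using assms unfolding mem_I_iff by (simp add: ulrich_f_def)

end

theorem theorem4p3:
  fixes \<alpha>1 \<alpha>2 \<alpha>3 :: "'k::field"
  assumes "\<alpha>1 \<noteq> 0"
  shows "ulrich_ideal A_5_11 (Idl\<^bsub>A_5_11\<^esub> {ulrich_f \<alpha>1 \<alpha>2 \<alpha>3, ulrich_g}) \<and>
    (\<forall>\<beta>1 \<beta>2 \<beta>3 :: 'k. \<beta>1 \<noteq> 0 \<and>
       Idl\<^bsub>A_5_11\<^esub> {ulrich_f \<beta>1 \<beta>2 \<beta>3, ulrich_g} = Idl\<^bsub>A_5_11\<^esub> {ulrich_f \<alpha>1 \<alpha>2 \<alpha>3, ulrich_g}
       \<longrightarrow> \<beta>1 = \<alpha>1 \<and> \<beta>2 = \<alpha>2 \<and> \<beta>3 = \<alpha>3)"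
proof (intro conjI allI impI)
  have loc: "ulrich_5_11 (A_5_11 :: 'k fps ring) \<gamma>" if "\<gamma> \<noteq> 0" for \<gamma>
    using numerical_semigroup_ring_5_11 that by (simp add: ulrich_5_11_def ulrich_5_11_axioms_def)
  show "ulrich_ideal A_5_11 (Idl\<^bsub>A_5_11\<^esub> {ulrich_f \<alpha>1 \<alpha>2 \<alpha>3, ulrich_g})"
    by (rule ulrich_5_11.ulrich[OF loc[OF assms]])
  fix \<beta>1 \<beta>2 \<beta>3 :: 'k
  assume "\<beta>1 \<noteq> 0 \<and>
    Idl\<^bsub>A_5_11\<^esub> {ulrich_f \<beta>1 \<beta>2 \<beta>3, ulrich_g} = Idl\<^bsub>A_5_11\<^esub> {ulrich_f \<alpha>1 \<alpha>2 \<alpha>3, ulrich_g}"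
  then have "ulrich_f \<beta>1 \<beta>2 \<beta>3 \<in> Idl\<^bsub>A_5_11\<^esub> {ulrich_f \<alpha>1 \<alpha>2 \<alpha>3, ulrich_g}"
    using ulrich_5_11.f_in_I[OF loc] by metis
  from ulrich_5_11.parameters_unique[OF loc[OF assms] this]
  show "\<beta>1 = \<alpha>1" "\<beta>2 = \<alpha>2" "\<beta>3 = \<alpha>3" by auto
qed

end
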